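(* Assume $n=2t$ is even and let $\mathbb{L}'$ be the subfield with $\mathbb{K}\le\mathbb{L}'<\mathbb{L}$ and $[\mathbb{L}:\mathbb{L}']=2$. Let $f$ be a monic irreducible element of $R$ with $f\notin Z(R)$, whose bound is $F(x^n)$ with $F(y)\in\mathbb{K}[y]$ monic irreducible of degree $s$, $F(y)\ne y$, and assume $\deg f=s\ell$ with $\ell=\ell_F$. Let $\gamma\in\mathbb{L}$ be such that $\gamma/f_0\in\mathbb{L}\setminus\mathbb{L}'$ and $\mathrm{N}_{\mathbb{L}/\mathbb{K}}(\gamma)$ is not a square in $\mathbb{K}$, where $f_0$ is the constant coefficient of $f$. On $R/Rf$, the operation $$a\star_D b:=\Big((a_0'+\gamma a_0'')+\sum_{i=1}^{s\ell-1}a_ix^i-\frac{\gamma}{f_0}a_0''f(x)\Big)b \bmod_r f,\qquad a=(a_0'+\gamma a_0'')+\sum_{i=1}^{s\ell-1}a_ix^i,$$ with $a_i\in\mathbb{L}$, $a_0',a_0''\in\mathbb{L}'$, $b\in R/Rf$, defines a unital division algebra over $\mathbb{K}$ with unity $1$, of dimension $ns\ell$.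
   Context: $\mathbb{K}$ is a field, $\mathbb{L}/\mathbb{K}$ cyclic Galois of degree $n$, $\sigma$ a generator of $\mathrm{Gal}(\mathbb{L}/\mathbb{K})$, $R=\mathbb{L}[x;\sigma]$ with $xa=\sigma(a)x$, $Z(R)=\mathbb{K}[x^n]$. The bound of $f$ is the monic central polynomial generating the largest two-sided ideal in $Rf$; $\ell_F=n/m$ with $m$ the number of irreducible factors of $F(x^n)$ in $R$. $R/Rf$ is identified with polynomials of degree $<\deg f$ and $\bmod_r f$ is the remainder of right division by $f$. Since $\gamma\notin\mathbb{L}'$, every element of $R/Rf$ is uniquely written as $(a_0'+\gamma a_0'')+\sum_{i=1}^{s\ell-1}a_ix^i$ with $a_0',a_0''\in\mathbb{L}'$, $a_i\in\mathbb{L}$. A division algebra is a finite-dimensional algebra in which multiplication on either side by a nonzero element is bijective. *)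

theory Defs
  imports
    "Jordan_Normal_Form.Char_Poly"
    "HOL-Algebra.Ideal"
    "HOL-Algebra.Generated_Groups"
    "HOL-Computational_Algebra.Polynomial"
begin

section \<open>Field extensions\<close>

text \<open>
  A field extension is a homomorphism \<open>\<iota>\<close> between two field types, the base field being
  identified with \<open>range \<iota>\<close>.
\<close>

text \<open>\<^const>\<open>vector_space.dim\<close> is 0 on an infinite-dimensional space, so
  \<open>0 < ext_degree \<iota>\<close> says that the extension is finite.\<close>

definition ext_degree :: "('k::field \<Rightarrow> 'l::field) \<Rightarrow> nat" where
  "ext_degree \<iota> = vector_space.dim (\<lambda>k a. \<iota> k * a) UNIV"

definition galois_group :: "('k::field \<Rightarrow> 'l::field) \<Rightarrow> ('l \<Rightarrow> 'l) monoid" where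
  "galois_group \<iota> =
     \<lparr>carrier = {\<tau>. field_hom \<tau> \<and> bij \<tau> \<and> (\<forall>k. \<tau> (\<iota> k) = \<iota> k)},
      mult = (\<circ>), one = id\<rparr>"

definition galois_extension :: "('k::field \<Rightarrow> 'l::field) \<Rightarrow> bool" where
  "galois_extension \<iota> \<longleftrightarrow>
     field_hom \<iota> \<and> 0 < ext_degree \<iota> \<and>
     {a. \<forall>\<tau> \<in> carrier (galois_group \<iota>). \<tau> a = a} = range \<iota>"

definition cyclic_galois_extension :: "('k::field \<Rightarrow> 'l::field) \<Rightarrow> ('l \<Rightarrow> 'l) \<Rightarrow> bool" where
  "cyclic_galois_extension \<iota> \<sigma> \<longleftrightarrow>
     galois_extension \<iota> \<and> \<sigma> \<in> carrier (galois_group \<iota>) \<and>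
     generate (galois_group \<iota>) {\<sigma>} = carrier (galois_group \<iota>)"

definition galois_norm :: "('k::field \<Rightarrow> 'l::field) \<Rightarrow> 'l \<Rightarrow> 'l" where
  "galois_norm \<iota> a = (\<Prod>\<tau> \<in> carrier (galois_group \<iota>). \<tau> a)"


section \<open>The skew polynomial ring\<close>

text \<open>
  The elements of \<open>L[x;\<sigma>]\<close> are written with coefficients on the left of the powers of \<open>x\<close>, so
  that the underlying additive group, degrees and coefficients are those of the commutative
  type \<^typ>\<open>'l poly\<close>.  Only the product is different:
  \<open>(a x^i) (b x^j) = a \<sigma>^i(b) x^(i+j)\<close>.
\<close>

definition skew_mult :: "('l::field \<Rightarrow> 'l) \<Rightarrow> 'l poly \<Rightarrow> 'l poly \<Rightarrow> 'l poly" where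
  "skew_mult \<sigma> p q =
     (\<Sum>i\<le>degree p. \<Sum>j\<le>degree q. Polynomial.monom (coeff p i * (\<sigma> ^^ i) (coeff q j)) (i + j))"

definition skew_ring :: "('l::field \<Rightarrow> 'l) \<Rightarrow> 'l poly ring" where
  "skew_ring \<sigma> =
     \<lparr>carrier = UNIV, mult = skew_mult \<sigma>, one = 1, zero = 0, add = (+)\<rparr>"

definition skew_center :: "('l::field \<Rightarrow> 'l) \<Rightarrow> 'l poly set" where
  "skew_center \<sigma> = {z. \<forall>p. skew_mult \<sigma> z p = skew_mult \<sigma> p z}"

definition skew_irreducible :: "('l::field \<Rightarrow> 'l) \<Rightarrow> 'l poly \<Rightarrow> bool" where
  "skew_irreducible \<sigma> f \<longleftrightarrow>
     f \<noteq> 0 \<and> f \<notin> Units (skew_ring \<sigma>) \<and>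
     (\<forall>g h. f = skew_mult \<sigma> g h \<longrightarrow> g \<in> Units (skew_ring \<sigma>) \<or> h \<in> Units (skew_ring \<sigma>))"

definition skew_left_ideal :: "('l::field \<Rightarrow> 'l) \<Rightarrow> 'l poly \<Rightarrow> 'l poly set" where
  "skew_left_ideal \<sigma> f = {skew_mult \<sigma> g f | g. True}"

definition is_skew_bound :: "('l::field \<Rightarrow> 'l) \<Rightarrow> 'l poly \<Rightarrow> 'l poly \<Rightarrow> bool" where
  "is_skew_bound \<sigma> f b \<longleftrightarrow>
     lead_coeff b = 1 \<and> b \<in> skew_center \<sigma> \<and>
     genideal (skew_ring \<sigma>) {b} \<subseteq> skew_left_ideal \<sigma> f \<and>
     (\<forall>I. ideal I (skew_ring \<sigma>) \<and> I \<subseteq> skew_left_ideal \<sigma> f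
            \<longrightarrow> I \<subseteq> genideal (skew_ring \<sigma>) {b})"

text \<open>The element \<open>F(x^n)\<close> of \<open>L[x;\<sigma>]\<close>.\<close>

definition subst_power :: "('k::field \<Rightarrow> 'l::field) \<Rightarrow> nat \<Rightarrow> 'k poly \<Rightarrow> 'l poly" where
  "subst_power \<iota> n F = (\<Sum>i\<le>degree F. Polynomial.monom (\<iota> (coeff F i)) (n * i))"

text \<open>
  The number of irreducible factors is well defined for nonzero polynomials, because
  \<open>L[x;\<sigma>]\<close> is a (noncommutative) principal ideal domain, hence all factorizations into
  irreducibles have the same length.
\<close>

definition skew_num_factors :: "('l::field \<Rightarrow> 'l) \<Rightarrow> 'l poly \<Rightarrow> nat" where
  "skew_num_factors \<sigma> g =
     (THE m. \<exists>gs. length gs = m \<and> (\<forall>h \<in> set gs. skew_irreducible \<sigma> h) \<and>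
                  g = foldr (skew_mult \<sigma>) gs 1)"

text \<open>The division is exact for irreducible \<open>F\<close> with \<open>F \<noteq> y\<close>.\<close>

definition skew_ell :: "('k::field \<Rightarrow> 'l::field) \<Rightarrow> ('l \<Rightarrow> 'l) \<Rightarrow> 'k poly \<Rightarrow> nat" where
  "skew_ell \<iota> \<sigma> F =
     ext_degree \<iota> div skew_num_factors \<sigma> (subst_power \<iota> (ext_degree \<iota>) F)"

definition skew_mod :: "('l::field \<Rightarrow> 'l) \<Rightarrow> 'l poly \<Rightarrow> 'l poly \<Rightarrow> 'l poly" where
  "skew_mod \<sigma> g f =
     (THE r. (r = 0 \<or> degree r < degree f) \<and> (\<exists>q. g = skew_mult \<sigma> q f + r))"


section \<open>The multiplication on the residue classes modulo \<open>f\<close>\<close>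

text \<open>For \<open>[L:E] = 2\<close> and \<open>\<gamma> \<notin> E\<close>, this is the component \<open>a''\<close> of \<open>a = a' + \<gamma> a''\<close>
  with \<open>a', a'' \<in> E\<close>.\<close>

definition gamma_component :: "'l::field set \<Rightarrow> 'l \<Rightarrow> 'l \<Rightarrow> 'l" where
  "gamma_component E \<gamma> a = (THE a''. a'' \<in> E \<and> (\<exists>a' \<in> E. a = a' + \<gamma> * a''))"

definition star_D ::
    "('l::field \<Rightarrow> 'l) \<Rightarrow> 'l set \<Rightarrow> 'l \<Rightarrow> 'l poly \<Rightarrow> 'l poly \<Rightarrow> 'l poly \<Rightarrow> 'l poly" where
  "star_D \<sigma> E \<gamma> f a b =
     skew_mod \<sigma>
       (skew_mult \<sigma> (a - Polynomial.smult (\<gamma> / coeff f 0 * gamma_component E \<gamma> (coeff a 0)) f) b) f"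


section \<open>Nonassociative division algebras\<close>

locale division_algebra_on = vector_space scale
  for scale :: "'k::field \<Rightarrow> 'v::ab_group_add \<Rightarrow> 'v" +
  fixes A :: "'v set" and prod :: "'v \<Rightarrow> 'v \<Rightarrow> 'v"
  assumes subspace_carrier: "subspace A"
    and finite_dim: "\<exists>B. finite B \<and> span B = A"
    and prod_closed: "\<And>a b. a \<in> A \<Longrightarrow> b \<in> A \<Longrightarrow> prod a b \<in> A"
    and prod_add_left:
      "\<And>a b c. a \<in> A \<Longrightarrow> b \<in> A \<Longrightarrow> c \<in> A \<Longrightarrow> prod (a + b) c = prod a c + prod b c"
    and prod_add_right:
      "\<And>a b c. a \<in> A \<Longrightarrow> b \<in> A \<Longrightarrow> c \<in> A \<Longrightarrow> prod a (b + c) = prod a b + prod a c"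
    and prod_scale_left:
      "\<And>k a b. a \<in> A \<Longrightarrow> b \<in> A \<Longrightarrow> prod (scale k a) b = scale k (prod a b)"
    and prod_scale_right:
      "\<And>k a b. a \<in> A \<Longrightarrow> b \<in> A \<Longrightarrow> prod a (scale k b) = scale k (prod a b)"
    and bij_left: "\<And>a. a \<in> A \<Longrightarrow> a \<noteq> 0 \<Longrightarrow> bij_betw (\<lambda>b. prod a b) A A"
    and bij_right: "\<And>b. b \<in> A \<Longrightarrow> b \<noteq> 0 \<Longrightarrow> bij_betw (\<lambda>a. prod a b) A A"

locale unital_division_algebra_on = division_algebra_on +
  fixes e
  assumes unit_closed: "e \<in> A"
    and unit_left: "\<And>a. a \<in> A \<Longrightarrow> prod e a = a"
    and unit_right: "\<And>a. a \<in> A \<Longrightarrow> prod a e = a"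

end

theory Submission
  imports Defs
begin

text \<open>
  A zero divisor of \<open>\<star>\<^sub>D\<close> is a pair with \<open>g b \<in> R f\<close>, where \<open>g = a - (\<gamma>/f\<^sub>0) a\<^sub>0'' f\<close> has
  leading coefficient \<open>-(\<gamma>/f\<^sub>0) a\<^sub>0''\<close> in degree \<open>deg f\<close> and constant coefficient \<open>a\<^sub>0'\<close>. As \<open>f\<close> is
  irreducible, \<open>b\<close> and \<open>f\<close> are right coprime, so \<open>g\<close> is a left multiple of a polynomial similar to
  \<open>f\<close>; comparing degrees, \<open>g\<close> is a constant times a monic polynomial similar to \<open>f\<close>. Similar monic
  polynomials have constant coefficients of the same norm, which gives \<open>N(\<gamma>) = N(-a\<^sub>0'/a\<^sub>0'')\<close>. This is a
  square because \<open>N\<close> restricted to the subfield of index 2 is the square of the norm of that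
  subfield. Multiplications without kernel on a finite-dimensional space are bijective.
\<close>

section \<open>Arithmetic of skew polynomials\<close>

locale skew_poly = field_hom \<sigma> for \<sigma> :: "'l::field \<Rightarrow> 'l"
begin

abbreviation skew_times :: "'l poly \<Rightarrow> 'l poly \<Rightarrow> 'l poly" (infixl "\<star>" 70)
  where "p \<star> q \<equiv> skew_mult \<sigma> p q"

section \<open>Ring laws of the skew product\<close>

lemma field_hom_funpow: "field_hom (\<sigma> ^^ i)"
proof -
  have "(\<sigma> ^^ i) 0 = 0" "(\<sigma> ^^ i) 1 = 1"
    "(\<sigma> ^^ i) (x + y) = (\<sigma> ^^ i) x + (\<sigma> ^^ i) y"
    "(\<sigma> ^^ i) (x * y) = (\<sigma> ^^ i) x * (\<sigma> ^^ i) y" for x y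
    by (induction i) (simp_all add: hom_add hom_mult)
  then show ?thesis by unfold_locales auto
qed

sublocale funpow: field_hom "\<sigma> ^^ i" for i
  by (rule field_hom_funpow)

text \<open>Twisting the coefficients of \<open>q\<close> by \<open>\<sigma> ^^ i\<close> turns each
  row of the skew product into an ordinary product of polynomials. The free bound \<open>N\<close>
  gives left factors of different degrees a common range of summation.\<close>

lemma skew_mult_eq_sum:
  assumes "degree p \<le> N"
  shows "p \<star> q = (\<Sum>i\<le>N. Polynomial.monom (coeff p i) i * map_poly (\<sigma> ^^ i) q)"
proof -
  have "(\<Sum>j\<le>degree q. Polynomial.monom (c * (\<sigma> ^^ i) (coeff q j)) (i + j)) =
        Polynomial.monom c i * map_poly (\<sigma> ^^ i) q" for c i
  proof -
    have "map_poly (\<sigma> ^^ i) q = (\<Sum>j\<le>degree q. Polynomial.monom ((\<sigma> ^^ i) (coeff q j)) j)"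
      using poly_as_sum_of_monoms'[of "map_poly (\<sigma> ^^ i) q" "degree q"]
      by (simp add: coeff_map_poly degree_map_poly)
    then show ?thesis by (simp add: sum_distrib_left mult_monom)
  qed
  then have "p \<star> q = (\<Sum>i\<le>degree p. Polynomial.monom (coeff p i) i * map_poly (\<sigma> ^^ i) q)"
    by (simp add: skew_mult_def)
  also have "\<dots> = (\<Sum>i\<le>N. Polynomial.monom (coeff p i) i * map_poly (\<sigma> ^^ i) q)"
    using assms by (intro sum.mono_neutral_left) (auto simp: coeff_eq_0)
  finally show ?thesis .
qed

lemma skew_mult_add_left: "(p + q) \<star> r = p \<star> r + q \<star> r"
proof -
  define N where "N = max (degree p) (degree q)"
  have "degree p \<le> N" "degree q \<le> N" "degree (p + q) \<le> N"
    by (auto simp: N_def degree_add_le_max)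
  then show ?thesis
    by (simp add: skew_mult_eq_sum[of _ N] sum.distrib add_monom[symmetric] algebra_simps)
qed

lemma skew_mult_add_right: "p \<star> (q + r) = p \<star> q + p \<star> r"
  by (simp add: skew_mult_eq_sum[OF order_refl] sum.distrib algebra_simps
      funpow.map_poly_hom_add)

lemma skew_mult_zero [simp]: "0 \<star> q = 0" "p \<star> 0 = 0"
  by (simp_all add: skew_mult_def)

lemma skew_mult_minus_left: "(- p) \<star> q = - (p \<star> q)"
  using skew_mult_add_left[of p "- p" q] by (simp add: eq_neg_iff_add_eq_0 add.commute)

lemma skew_mult_diff_left: "(p - q) \<star> r = p \<star> r - q \<star> r"
  using skew_mult_add_left[of p "- q" r] by (simp add: skew_mult_minus_left)

lemma skew_mult_smult_left: "Polynomial.smult c p \<star> q = Polynomial.smult c (p \<star> q)"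
  by (simp add: skew_mult_eq_sum[of _ "degree p"] smult_sum2 smult_monom[symmetric])

text \<open>A constant passes through powers of x unchanged once \<open>\<sigma>\<close> fixes it.
  Elements of \<open>range \<iota>\<close> are of this kind, whence linearity over the base field in
  the right argument.\<close>

lemma skew_mult_smult_fixed_right:
  assumes "\<sigma> c = c"
  shows "p \<star> Polynomial.smult c q = Polynomial.smult c (p \<star> q)"
proof -
  have "(\<sigma> ^^ i) c = c" for i
    by (induction i) (auto simp: assms)
  then have "map_poly (\<sigma> ^^ i) (Polynomial.smult c q) = Polynomial.smult c (map_poly (\<sigma> ^^ i) q)" for i
    by (simp add: poly_eq_iff coeff_map_poly funpow.hom_mult)
  then show ?thesis
    by (simp add: skew_mult_eq_sum[OF order_refl] smult_sum2)
qed

lemma skew_mult_monom_left: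
  "Polynomial.monom c i \<star> q = Polynomial.monom c i * map_poly (\<sigma> ^^ i) q"
proof -
  have "(\<Sum>k\<le>i. Polynomial.monom (coeff (Polynomial.monom c i) k) k * map_poly (\<sigma> ^^ k) q) =
        (\<Sum>k\<in>{i}. Polynomial.monom (coeff (Polynomial.monom c i) k) k * map_poly (\<sigma> ^^ k) q)"
    by (intro sum.mono_neutral_right) auto
  then show ?thesis
    by (simp add: skew_mult_eq_sum[OF degree_monom_le])
qed

lemma skew_mult_const_left [simp]: "[:c:] \<star> q = Polynomial.smult c q"
  using skew_mult_monom_left[of c 0 q] by (simp add: monom_0 id_def)

lemma skew_mult_one_left [simp]: "1 \<star> q = q"
  using skew_mult_const_left[of 1 q] by (simp del: skew_mult_const_left add: one_pCons)

lemma skew_mult_one_right [simp]: "p \<star> 1 = p"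
  by (simp add: skew_mult_eq_sum[OF order_refl] poly_as_sum_of_monoms)

text \<open>\<open>pCons 0\<close> is right multiplication by x, so this is the commutation rule of
  x with a polynomial. It allows inductions on the left factor in place of reindexing double
  sums.\<close>

lemma skew_mult_pCons_zero_left: "pCons 0 p \<star> q = pCons 0 (p \<star> map_poly \<sigma> q)"
proof (rule poly_eqI)
  fix k
  have *: "map_poly (\<sigma> ^^ Suc i) q = map_poly (\<sigma> ^^ i) (map_poly \<sigma> q)" for i
    by (simp add: poly_eq_iff coeff_map_poly funpow_Suc_right del: funpow.simps)
  have "pCons 0 p \<star> q =
     (\<Sum>i\<le>Suc (degree p). Polynomial.monom (coeff (pCons 0 p) i) i * map_poly (\<sigma> ^^ i) q)"
    by (rule skew_mult_eq_sum) (rule degree_pCons_le)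
  also have "\<dots> = (\<Sum>i\<le>degree p. Polynomial.monom (coeff p i) (Suc i) * map_poly (\<sigma> ^^ Suc i) q)"
    by (subst sum.atMost_Suc_shift) simp
  also have "\<dots> = pCons 0 (p \<star> map_poly \<sigma> q)"
    by (simp only: *)
      (simp add: skew_mult_eq_sum[OF order_refl] monom_Suc poly_eq_iff coeff_pCons coeff_sum split: nat.split)
  finally show "coeff (pCons 0 p \<star> q) k = coeff (pCons 0 (p \<star> map_poly \<sigma> q)) k" by simp
qed

lemma skew_mult_pCons_left:
  "pCons a p \<star> q = Polynomial.smult a q + pCons 0 (p \<star> map_poly \<sigma> q)"
  using skew_mult_add_left[of "[:a:]" "pCons 0 p" q]
  by (simp add: skew_mult_pCons_zero_left)

lemma map_poly_skew_mult: "map_poly \<sigma> (p \<star> q) = map_poly \<sigma> p \<star> map_poly \<sigma> q"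
  by (induction p arbitrary: q)
     (simp_all add: skew_mult_pCons_left map_poly_hom_add map_poly_pCons_hom map_poly_hom_smult)

text \<open>Splitting off x from the left factor twists \<open>q\<close> and \<open>r\<close>. Since
  \<open>map_poly \<sigma>\<close> is multiplicative for the skew product, the induction hypothesis
  for the twisted factors closes the step.\<close>

lemma skew_mult_assoc: "(p \<star> q) \<star> r = p \<star> (q \<star> r)"
  by (induction p arbitrary: q r)
     (simp_all add: skew_mult_pCons_left skew_mult_add_left skew_mult_smult_left
       skew_mult_pCons_zero_left map_poly_skew_mult)

section \<open>Constant coefficients, leading coefficients and degrees\<close>

lemma coeff_0_skew_mult: "coeff (p \<star> q) 0 = coeff p 0 * coeff q 0"
  by (cases p) (simp add: skew_mult_pCons_left)

lemma degree_skew_mult_le: "degree (p \<star> q) \<le> degree p + degree q"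
proof -
  have "degree (Polynomial.monom (coeff p i) i * map_poly (\<sigma> ^^ i) q) \<le> degree p + degree q"
    if "i \<le> degree p" for i
    using that degree_mult_le[of "Polynomial.monom (coeff p i) i" "map_poly (\<sigma> ^^ i) q"]
      degree_monom_le[of "coeff p i" i] by (simp add: degree_map_poly)
  then show ?thesis
    unfolding skew_mult_eq_sum[OF order_refl] by (intro degree_sum_le) auto
qed

lemma coeff_skew_mult_degree_add:
  "coeff (p \<star> q) (degree p + degree q) = lead_coeff p * (\<sigma> ^^ degree p) (lead_coeff q)"
proof -
  have "coeff (p \<star> q) (degree p + degree q) =
    (\<Sum>i\<le>degree p. coeff (Polynomial.monom (coeff p i) i * map_poly (\<sigma> ^^ i) q) (degree p + degree q))"
    by (simp add: skew_mult_eq_sum[OF order_refl] coeff_sum)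
  also have "\<dots> = (\<Sum>i\<in>{degree p}. coeff (Polynomial.monom (coeff p i) i * map_poly (\<sigma> ^^ i) q) (degree p + degree q))"
    by (intro sum.mono_neutral_right) (auto simp: coeff_monom_mult coeff_map_poly coeff_eq_0)
  finally show ?thesis by (simp add: coeff_monom_mult coeff_map_poly)
qed

lemma degree_skew_mult:
  assumes "p \<noteq> 0" "q \<noteq> 0"
  shows "degree (p \<star> q) = degree p + degree q"
proof (rule antisym[OF degree_skew_mult_le])
  show "degree p + degree q \<le> degree (p \<star> q)"
    using assms by (intro le_degree) (simp add: coeff_skew_mult_degree_add)
qed

lemma skew_mult_eq_0_iff [simp]: "p \<star> q = 0 \<longleftrightarrow> p = 0 \<or> q = 0"
  using coeff_skew_mult_degree_add[of p q] by auto

lemma lead_coeff_skew_mult: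
  "lead_coeff (p \<star> q) = lead_coeff p * (\<sigma> ^^ degree p) (lead_coeff q)"
  by (cases "p = 0 \<or> q = 0") (auto simp: degree_skew_mult coeff_skew_mult_degree_add)

section \<open>Right division with remainder\<close>

lemma skew_division:
  assumes "f \<noteq> 0"
  shows "\<exists>q r. g = q \<star> f + r \<and> (r = 0 \<or> degree r < degree f)"
proof (induction "degree g" arbitrary: g rule: less_induct)
  case less
  show ?case
  proof (cases "g = 0 \<or> degree g < degree f")
    case True
    then show ?thesis by (intro exI[of _ 0] exI[of _ g]) auto
  next
    case False
    define k where "k = degree g - degree f"
    \<comment> \<open>Multiplying \<open>f\<close> on the left by c x^k applies
      \<open>\<sigma> ^^ k\<close> to its leading coefficient, hence the twisted
      denominator.\<close>
    define c where "c = lead_coeff g / (\<sigma> ^^ k) (lead_coeff f)"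
    define h where "h = Polynomial.monom c k"
    have lc: "(\<sigma> ^^ k) (lead_coeff f) \<noteq> 0" and "c \<noteq> 0"
      using assms False by (simp_all add: c_def)
    then have h: "h \<noteq> 0" "degree h = k" "lead_coeff h = c"
      by (simp_all add: h_def degree_monom_eq monom_eq_0_iff)
    have deg: "degree (h \<star> f) = degree g"
      using False h assms by (simp add: degree_skew_mult k_def)
    have "lead_coeff (h \<star> f) = lead_coeff g"
      using lc h by (simp add: lead_coeff_skew_mult c_def)
    then have g': "degree (g - h \<star> f) \<le> degree g" "coeff (g - h \<star> f) (degree g) = 0"
      using deg by (auto simp: degree_diff_le)
    show ?thesis
    proof (cases "g - h \<star> f = 0")
      case True
      then show ?thesis by (intro exI[of _ h] exI[of _ 0]) auto
    next
      case nz: False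
      then have "degree (g - h \<star> f) < degree g"
        using g' by (metis le_neq_implies_less leading_coeff_0_iff)
      from less[OF this] obtain q r where "g - h \<star> f = q \<star> f + r" "r = 0 \<or> degree r < degree f"
        by blast
      then show ?thesis
        by (intro exI[of _ "h + q"] exI[of _ r]) (auto simp: skew_mult_add_left algebra_simps)
    qed
  qed
qed

lemma skew_division_unique:
  assumes "q \<star> f + r = q' \<star> f + r'"
    and "r = 0 \<or> degree r < degree f" "r' = 0 \<or> degree r' < degree f"
  shows "r = r'"
proof (rule ccontr)
  assume "r \<noteq> r'"
  have eq: "(q - q') \<star> f = r' - r"
    using assms(1) by (simp add: skew_mult_diff_left algebra_simps)
  with \<open>r \<noteq> r'\<close> have "q - q' \<noteq> 0" "f \<noteq> 0" by auto
  then have "degree f \<le> degree (r' - r)"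
    by (simp flip: eq add: degree_skew_mult)
  moreover have "degree (r' - r) < degree f"
    using assms(2,3) \<open>r \<noteq> r'\<close> by (cases "r = 0"; cases "r' = 0") (auto simp: degree_diff_less)
  ultimately show False by simp
qed

lemma skew_mod_eqI:
  assumes "g = q \<star> f + r" "r = 0 \<or> degree r < degree f"
  shows "skew_mod \<sigma> g f = r"
  unfolding skew_mod_def
proof (rule the_equality)
  fix r' assume "(r' = 0 \<or> degree r' < degree f) \<and> (\<exists>q. g = q \<star> f + r')"
  then show "r' = r" using skew_division_unique assms by metis
qed (use assms in auto)

lemma skew_mod_division:
  assumes "f \<noteq> 0"
  obtains q where "g = q \<star> f + skew_mod \<sigma> g f"
    and "skew_mod \<sigma> g f = 0 \<or> degree (skew_mod \<sigma> g f) < degree f"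
  using skew_division[OF assms, of g] skew_mod_eqI by metis

lemma skew_mod_add:
  assumes "f \<noteq> 0"
  shows "skew_mod \<sigma> (g + h) f = skew_mod \<sigma> g f + skew_mod \<sigma> h f"
proof -
  obtain q q' where q: "g = q \<star> f + skew_mod \<sigma> g f"
    "skew_mod \<sigma> g f = 0 \<or> degree (skew_mod \<sigma> g f) < degree f"
    and q': "h = q' \<star> f + skew_mod \<sigma> h f"
    "skew_mod \<sigma> h f = 0 \<or> degree (skew_mod \<sigma> h f) < degree f"
    using skew_mod_division[OF assms] by metis
  show ?thesis
  proof (rule skew_mod_eqI)
    show "g + h = (q + q') \<star> f + (skew_mod \<sigma> g f + skew_mod \<sigma> h f)"
      by (subst q(1), subst q'(1)) (simp add: skew_mult_add_left)
  qed (use q(2) q'(2) in \<open>auto simp: degree_add_less\<close>)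
qed

lemma skew_mod_smult:
  assumes "f \<noteq> 0"
  shows "skew_mod \<sigma> (Polynomial.smult c g) f = Polynomial.smult c (skew_mod \<sigma> g f)"
proof -
  obtain q where q: "g = q \<star> f + skew_mod \<sigma> g f"
    "skew_mod \<sigma> g f = 0 \<or> degree (skew_mod \<sigma> g f) < degree f"
    using skew_mod_division[OF assms] by metis
  show ?thesis
  proof (rule skew_mod_eqI)
    show "Polynomial.smult c g = Polynomial.smult c q \<star> f + Polynomial.smult c (skew_mod \<sigma> g f)"
      by (subst q(1)) (simp add: skew_mult_smult_left smult_add_right)
  qed (use q(2) in auto)
qed

section \<open>The Euclidean algorithm and coprimality\<close>

lemma skew_bezout:
  "\<exists>h u v b' f'. h = u \<star> b + v \<star> f \<and> b = b' \<star> h \<and> f = f' \<star> h"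
\<comment> \<open>\<open>Suc\<close> ranks nonzero constants above 0, so the measure also drops in
  the last division, where a constant \<open>b\<close> leaves remainder 0.\<close>
proof (induction "if b = 0 then 0 else Suc (degree b)" arbitrary: b f rule: less_induct)
  case less
  show ?case
  proof (cases "b = 0")
    case True
    then show ?thesis by (intro exI[of _ f] exI[of _ 0] exI[of _ 1]) auto
  next
    case False
    obtain q r where qr: "f = q \<star> b + r" "r = 0 \<or> degree r < degree b"
      using skew_division[OF False] by metis
    then have "(if r = 0 then 0 else Suc (degree r)) < (if b = 0 then 0 else Suc (degree b))"
      using False by auto
    from less[OF this, of b] obtain h u v r' b'
      where h: "h = u \<star> r + v \<star> b" "r = r' \<star> h" "b = b' \<star> h"
      by blast
    have "h = (v - u \<star> q) \<star> b + u \<star> f"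
      by (subst qr(1))
        (simp add: h(1) skew_mult_diff_left skew_mult_add_right skew_mult_assoc)
    moreover have "f = (q \<star> b' + r') \<star> h"
      by (simp add: qr(1) h(2,3)[symmetric] skew_mult_add_left skew_mult_assoc)
    ultimately show ?thesis using h(3) by blast
  qed
qed

lemma Units_skew_ring_iff: "p \<in> Units (skew_ring \<sigma>) \<longleftrightarrow> p \<noteq> 0 \<and> degree p = 0"
proof
  assume "p \<in> Units (skew_ring \<sigma>)"
  then obtain q where "p \<star> q = 1"
    by (auto simp: Units_def skew_ring_def)
  then have "degree (p \<star> q) = 0" "p \<noteq> 0" "q \<noteq> 0" by auto
  then show "p \<noteq> 0 \<and> degree p = 0"
    by (simp add: degree_skew_mult)
next
  assume "p \<noteq> 0 \<and> degree p = 0"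
  then obtain c where "p = [:c:]" "c \<noteq> 0"
    by (metis degree_eq_zeroE pCons_0_0)
  then have "p \<star> [:inverse c:] = 1" "[:inverse c:] \<star> p = 1"
    by (simp_all add: one_pCons)
  then show "p \<in> Units (skew_ring \<sigma>)"
    by (auto simp: Units_def skew_ring_def simp del: skew_mult_const_left)
qed

text \<open>A common right divisor \<open>h\<close> from the Bezout relation has degree at most that
  of \<open>b\<close>, below that of \<open>f\<close>. The cofactor of \<open>h\<close> in
  \<open>f\<close> is then not a unit, so irreducibility makes \<open>h\<close> a nonzero constant,
  which can be scaled to 1.\<close>

lemma skew_irreducible_coprime:
  assumes "skew_irreducible \<sigma> f" "b \<noteq> 0" "degree b < degree f"
  shows "\<exists>u v. u \<star> b + v \<star> f = 1"
proof -
  obtain h u v b' f' where h: "h = u \<star> b + v \<star> f" "b = b' \<star> h" "f = f' \<star> h"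
    using skew_bezout by metis
  have "f \<noteq> 0" using assms(1) by (simp add: skew_irreducible_def)
  then have nz: "f' \<noteq> 0" "h \<noteq> 0" "b' \<noteq> 0" using h(2,3) assms(2) by auto
  have "degree h \<le> degree b"
    using nz by (subst h(2)) (simp add: degree_skew_mult)
  moreover have "degree f = degree f' + degree h"
    using nz by (subst h(3)) (simp add: degree_skew_mult)
  ultimately have "degree f' \<noteq> 0" using assms(3) by simp
  moreover have "f' \<in> Units (skew_ring \<sigma>) \<or> h \<in> Units (skew_ring \<sigma>)"
    using assms(1) h(3) by (simp add: skew_irreducible_def)
  ultimately have "degree h = 0" by (auto simp: Units_skew_ring_iff)
  then obtain c where c: "h = [:c:]" "c \<noteq> 0"
    using nz by (metis degree_eq_zeroE pCons_0_0)
  have "([:inverse c:] \<star> u) \<star> b + ([:inverse c:] \<star> v) \<star> f = [:inverse c:] \<star> h"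
    by (subst h(1)) (simp only: skew_mult_add_right skew_mult_assoc)
  also have "\<dots> = 1" using c by (simp add: one_pCons)
  finally show ?thesis by blast
qed

lemma skew_irreducible_degree_pos:
  assumes "skew_irreducible \<sigma> f"
  shows "0 < degree f"
  using assms by (auto simp: skew_irreducible_def Units_skew_ring_iff)

text \<open>
  The relation \<open>c \<star> b = e \<star> f\<close> with \<open>b\<close> and \<open>f\<close> right coprime says that \<open>c\<close> is a left multiple
  of a polynomial similar to \<open>f\<close>.  One step \<open>f = q \<star> b + r\<close> of the Euclidean algorithm turns it
  into \<open>e \<star> r = (c - e \<star> q) \<star> b\<close>, and keeping track of a common factor \<open>w\<close> of both pairs of
  constant coefficients avoids any division by them, so that they may vanish.
\<close>

lemma skew_similar_constant_coeff:
  fixes N :: "'l \<Rightarrow> 'l"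
  assumes N_mult: "\<And>x y. N (x * y) = N x * N y"
    and N_hom: "\<And>x. N (\<sigma> x) = N x"
    and N_nz: "\<And>x. x \<noteq> 0 \<Longrightarrow> N x \<noteq> 0"
  assumes "c \<star> b = e \<star> f" "u \<star> b + v \<star> f = 1" "c \<noteq> 0" "f \<noteq> 0"
  shows "degree f \<le> degree c \<and>
    (degree c = degree f \<longrightarrow>
      (\<exists>w. coeff c 0 = w * coeff f 0 \<and> coeff e 0 = w * coeff b 0 \<and>
           N w * N (lead_coeff f) = N (lead_coeff c)))"
  using assms(4-)
proof (induction "if b = 0 then 0 else Suc (degree b)" arbitrary: c b e f u v rule: less_induct)
  case less
  have N_funpow: "N ((\<sigma> ^^ i) x) = N x" for i x
    by (induction i) (auto simp: N_hom)
  show ?case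
  proof (cases "b = 0")
    \<comment> \<open>End of the algorithm: \<open>v \<star> f = 1\<close> makes \<open>f\<close> a
      nonzero constant, so here dividing by its constant coefficient is legitimate.\<close>
    case True
    with less.prems have "e = 0" "v \<star> f = 1" by auto
    then have "v \<noteq> 0" "degree (v \<star> f) = 0" by auto
    then have "degree f = 0" using less.prems by (simp add: degree_skew_mult)
    moreover from this have "coeff f 0 \<noteq> 0" using less.prems(4) by (metis leading_coeff_0_iff)
    ultimately show ?thesis using True \<open>e = 0\<close>
      by (auto intro!: exI[of _ "coeff c 0 / coeff f 0"] simp flip: N_mult)
  next
    case False
    with less.prems(3) have "c \<star> b \<noteq> 0" by simp
    then have "e \<noteq> 0" by (auto simp: less.prems(1))
    have deg: "degree c + degree b = degree e + degree f"
      using degree_skew_mult[of c b] degree_skew_mult[of e f] less.prems False \<open>e \<noteq> 0\<close> by simp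
    obtain q r where qr: "f = q \<star> b + r" "r = 0 \<or> degree r < degree b"
      using skew_division[OF False] by metis
    have "e \<star> r = (c - e \<star> q) \<star> b"
      using less.prems(1) by (simp add: qr(1) skew_mult_diff_left skew_mult_add_right skew_mult_assoc)
    moreover have "v \<star> r + (u + v \<star> q) \<star> b = 1"
      using less.prems(2)
      by (simp add: qr(1) skew_mult_add_left skew_mult_add_right skew_mult_assoc add_ac)
    \<comment> \<open>The hypothesis is applied with \<open>e\<close>, \<open>r\<close>,
      \<open>c - e \<star> q\<close>, \<open>b\<close> in the roles of \<open>c\<close>,
      \<open>b\<close>, \<open>e\<close>, \<open>f\<close>.\<close>
    ultimately have IH: "degree b \<le> degree e \<and> (degree e = degree b \<longrightarrow>
      (\<exists>w. coeff e 0 = w * coeff b 0 \<and> coeff (c - e \<star> q) 0 = w * coeff r 0 \<and>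
           N w * N (lead_coeff b) = N (lead_coeff e)))"
      using less.hyps[of r e "c - e \<star> q" b v "u + v \<star> q"] qr(2) False \<open>e \<noteq> 0\<close> by auto
    show ?thesis
    proof (intro conjI impI)
      show "degree f \<le> degree c" using IH deg by simp
      assume "degree c = degree f"
      with deg IH obtain w where w: "coeff e 0 = w * coeff b 0"
        "coeff (c - e \<star> q) 0 = w * coeff r 0" "N w * N (lead_coeff b) = N (lead_coeff e)"
        by auto
      have "coeff c 0 = w * coeff f 0"
        using w(1,2) by (simp add: qr(1) coeff_0_skew_mult algebra_simps)
      \<comment> \<open>\<open>N\<close> absorbs the powers of \<open>\<sigma>\<close> in the
        leading coefficients of the two products; the factor belonging to \<open>b\<close> then
        cancels.\<close>
      moreover have "N (lead_coeff c) * N (lead_coeff b) = N (lead_coeff e) * N (lead_coeff f)"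
        using arg_cong[OF less.prems(1), of "\<lambda>p. N (lead_coeff p)"]
        by (simp add: lead_coeff_skew_mult N_mult N_funpow)
      then have "N w * N (lead_coeff f) = N (lead_coeff c)"
        using N_nz[of "lead_coeff b"] False by (simp flip: w(3) add: algebra_simps)
      ultimately show "\<exists>w. coeff c 0 = w * coeff f 0 \<and> coeff e 0 = w * coeff b 0 \<and>
           N w * N (lead_coeff f) = N (lead_coeff c)"
        using w(1) by blast
    qed
  qed
qed

end

section \<open>The Galois group and the norm\<close>

lemma vector_space_field_hom:
  assumes "field_hom \<iota>"
  shows "vector_space (\<lambda>k a. \<iota> k * a)"
proof -
  interpret field_hom \<iota> by fact
  show ?thesis by unfold_locales (auto simp: hom_add hom_mult algebra_simps)
qed

lemma (in field_hom) hom_comp: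
  assumes "field_hom \<tau>"
  shows "field_hom (\<tau> \<circ> hom)"
proof -
  interpret \<tau>: field_hom \<tau> by fact
  show ?thesis by unfold_locales (auto simp: hom_add hom_mult \<tau>.hom_add \<tau>.hom_mult)
qed

lemma (in field_hom) field_hom_inv:
  assumes "bij hom"
  shows "field_hom (inv_into UNIV hom)"
proof -
  have "inv_into UNIV hom x = y \<longleftrightarrow> x = hom y" for x y
    using assms by (metis bij_inv_eq_iff)
  moreover have "hom (inv_into UNIV hom x) = x" for x
    using assms by (simp add: bij_is_surj surj_f_inv_f)
  ultimately show ?thesis
    by unfold_locales (auto simp: hom_add hom_mult)
qed

lemma group_galois_group: "group (galois_group \<iota>)"
proof (rule groupI)
  fix \<tau> \<rho> assume "\<tau> \<in> carrier (galois_group \<iota>)" "\<rho> \<in> carrier (galois_group \<iota>)"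
  then show "\<tau> \<otimes>\<^bsub>galois_group \<iota>\<^esub> \<rho> \<in> carrier (galois_group \<iota>)"
    using field_hom.hom_comp[of \<rho> \<tau>] by (auto simp: galois_group_def bij_comp)
next
  have "field_hom id" by unfold_locales auto
  then show "\<one>\<^bsub>galois_group \<iota>\<^esub> \<in> carrier (galois_group \<iota>)"
    by (auto simp: galois_group_def)
next
  fix \<tau> assume \<tau>: "\<tau> \<in> carrier (galois_group \<iota>)"
  show "\<exists>\<rho>\<in>carrier (galois_group \<iota>). \<rho> \<otimes>\<^bsub>galois_group \<iota>\<^esub> \<tau> = \<one>\<^bsub>galois_group \<iota>\<^esub>"
  proof
    show "inv_into UNIV \<tau> \<otimes>\<^bsub>galois_group \<iota>\<^esub> \<tau> = \<one>\<^bsub>galois_group \<iota>\<^esub>"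
      using \<tau> by (simp add: galois_group_def bij_is_inj)
    show "inv_into UNIV \<tau> \<in> carrier (galois_group \<iota>)"
      using \<tau> by (auto simp: galois_group_def field_hom.field_hom_inv bij_imp_bij_inv bij_is_inj inv_f_eq)
  qed
qed (auto simp: galois_group_def)

lemma galois_group_mult [simp]: "\<tau> \<otimes>\<^bsub>galois_group \<iota>\<^esub> \<rho> = \<tau> \<circ> \<rho>"
  and galois_group_one [simp]: "\<one>\<^bsub>galois_group \<iota>\<^esub> = id"
  by (simp_all add: galois_group_def)

text \<open>Composition with the inverse of \<open>\<sigma>\<close> undoes each translation. The
  left one serves to permute an orbit, the right one to reindex the norm.\<close>

lemma galois_group_bij_betw_comp:
  assumes "\<sigma> \<in> carrier (galois_group \<iota>)"
  shows "bij_betw (\<lambda>\<tau>. \<sigma> \<circ> \<tau>) (carrier (galois_group \<iota>)) (carrier (galois_group \<iota>))"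
    and "bij_betw (\<lambda>\<tau>. \<tau> \<circ> \<sigma>) (carrier (galois_group \<iota>)) (carrier (galois_group \<iota>))"
proof -
  interpret group "galois_group \<iota>" by (rule group_galois_group)
  let ?i = "inv\<^bsub>galois_group \<iota>\<^esub> \<sigma>"
  have m: "\<tau> \<circ> \<rho> \<in> carrier (galois_group \<iota>)"
    if "\<tau> \<in> carrier (galois_group \<iota>)" "\<rho> \<in> carrier (galois_group \<iota>)" for \<tau> \<rho>
    using m_closed[OF that] by simp
  have i: "?i \<in> carrier (galois_group \<iota>)" "?i \<circ> \<sigma> = id" "\<sigma> \<circ> ?i = id"
    using assms l_inv[OF assms] r_inv[OF assms] by simp_all
  show "bij_betw (\<lambda>\<tau>. \<sigma> \<circ> \<tau>) (carrier (galois_group \<iota>)) (carrier (galois_group \<iota>))"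
    by (rule bij_betw_byWitness[where f' = "\<lambda>\<tau>. ?i \<circ> \<tau>"])
      (use assms m i in \<open>auto simp flip: o_assoc simp: o_assoc[of \<sigma> ?i] o_assoc[of ?i \<sigma>]\<close>)
  show "bij_betw (\<lambda>\<tau>. \<tau> \<circ> \<sigma>) (carrier (galois_group \<iota>)) (carrier (galois_group \<iota>))"
    by (rule bij_betw_byWitness[where f' = "\<lambda>\<tau>. \<tau> \<circ> ?i"])
      (use assms m i in \<open>auto simp: comp_assoc\<close>)
qed

lemma galois_norm_mult: "galois_norm \<iota> (a * b) = galois_norm \<iota> a * galois_norm \<iota> b"
proof -
  have "\<tau> (a * b) = \<tau> a * \<tau> b" if "\<tau> \<in> carrier (galois_group \<iota>)" for \<tau>
  proof -
    interpret field_hom \<tau> using that by (simp add: galois_group_def)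
    show ?thesis by (rule hom_mult)
  qed
  then show ?thesis
    unfolding galois_norm_def prod.distrib[symmetric] by (intro prod.cong) simp_all
qed

lemma galois_norm_nonzero:
  assumes "a \<noteq> 0"
  shows "galois_norm \<iota> a \<noteq> 0"
proof (cases "finite (carrier (galois_group \<iota>))")
  case True
  have "\<tau> a \<noteq> 0" if "\<tau> \<in> carrier (galois_group \<iota>)" for \<tau>
  proof -
    interpret field_hom \<tau> using that by (simp add: galois_group_def)
    show ?thesis using assms by simp
  qed
  then show ?thesis using True by (simp add: galois_norm_def)
\<comment> \<open>A product over an infinite set is 1 by convention.\<close>
qed (simp add: galois_norm_def)

lemma galois_norm_invariant:
  assumes "\<sigma> \<in> carrier (galois_group \<iota>)"
  shows "galois_norm \<iota> (\<sigma> a) = galois_norm \<iota> a"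
  unfolding galois_norm_def
  using prod.reindex_bij_betw[OF galois_group_bij_betw_comp(2)[OF assms], of "\<lambda>\<tau>. \<tau> a"] by simp

text \<open>Finiteness forces two powers of \<open>\<sigma>\<close> to coincide, so a least positive
  exponent \<open>N\<close> with trivial power exists. Powers below \<open>N\<close> are distinct,
  and reduction modulo \<open>N\<close> shows that they exhaust the generated subgroup. The norm
  thereby becomes a product over \<open>i < N\<close>.\<close>

lemma cyclic_galois_group_enum:
  assumes \<sigma>: "\<sigma> \<in> carrier (galois_group \<iota>)"
    and gen: "generate (galois_group \<iota>) {\<sigma>} = carrier (galois_group \<iota>)"
    and fin: "finite (carrier (galois_group \<iota>))"
  obtains N where "0 < N" "\<sigma> ^^ N = id" "bij_betw (\<lambda>i. \<sigma> ^^ i) {..<N} (carrier (galois_group \<iota>))"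
proof -
  interpret G: group "galois_group \<iota>" by (rule group_galois_group)
  have pow: "\<sigma> ^^ i \<in> carrier (galois_group \<iota>)" for i
  proof (induction i)
    case 0
    show ?case using G.one_closed by (simp add: id_def)
  next
    case (Suc i)
    then show ?case using G.m_closed[OF \<sigma> Suc] by (simp add: comp_def)
  qed
  have bij: "bij (\<sigma> ^^ i)" for i using pow[of i] by (simp add: galois_group_def)
  have diff: "\<sigma> ^^ (b - a) = id" if "\<sigma> ^^ a = \<sigma> ^^ b" "a \<le> b" for a b
  proof -
    have "\<sigma> ^^ a \<circ> \<sigma> ^^ (b - a) = \<sigma> ^^ (a + (b - a))"
      by (simp only: funpow_add)
    also have "\<dots> = \<sigma> ^^ a \<circ> id" using that by simp
    finally have "\<sigma> ^^ a \<circ> \<sigma> ^^ (b - a) = \<sigma> ^^ a \<circ> id" .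
    then show ?thesis
      using bij_is_inj[OF bij[of a]] by (auto simp: fun_eq_iff inj_eq)
  qed
  define P where "P = (\<lambda>n. 0 < n \<and> \<sigma> ^^ n = id)"
  have "\<not> inj (\<lambda>i. \<sigma> ^^ i)"
    using finite_subset[OF _ fin, of "range (\<lambda>i. \<sigma> ^^ i)"] pow finite_imageD by fastforce
  then obtain a b where "a < b" "\<sigma> ^^ a = \<sigma> ^^ b"
    by (metis injI linorder_neqE_nat)
  then have "P (b - a)" using diff[of a b] by (simp add: P_def)
  define N where "N = (LEAST n. P n)"
  have "P N" unfolding N_def by (rule LeastI) fact
  then have N: "0 < N" "\<sigma> ^^ N = id" by (simp_all add: P_def)
  have "\<sigma> ^^ a \<noteq> \<sigma> ^^ b" if "a < b" "b < N" for a b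
    using diff[of a b] that not_less_Least[of "b - a" P] by (auto simp: N_def P_def)
  then have inj: "inj_on (\<lambda>i. \<sigma> ^^ i) {..<N}"
    by (intro inj_onI) (metis lessThan_iff linorder_neqE_nat)
  have mod: "\<sigma> ^^ i = \<sigma> ^^ (i mod N)" for i
  proof -
    have "\<sigma> ^^ (N * m) = id" for m by (induction m) (simp_all add: N funpow_add)
    then have "\<sigma> ^^ (i mod N + N * (i div N)) = \<sigma> ^^ (i mod N)"
      by (simp only: funpow_add comp_id)
    then show ?thesis by (simp only: mod_mult_div_eq)
  qed
  have "\<exists>i. \<tau> = \<sigma> ^^ i" if "\<tau> \<in> generate (galois_group \<iota>) {\<sigma>}" for \<tau>
    using that
  proof induction
    case one
    show ?case by (intro exI[of _ 0]) auto
  next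
    case (incl h)
    then show ?case by (intro exI[of _ 1]) auto
  next
    case (inv h)
    have "\<sigma> ^^ (N - 1) \<circ> \<sigma> = id"
      using N by (metis Suc_diff_1 funpow_Suc_right)
    then have "inv\<^bsub>galois_group \<iota>\<^esub> \<sigma> = \<sigma> ^^ (N - 1)"
      using G.inv_equality[OF _ \<sigma> pow[of "N - 1"]] by simp
    then show ?case using inv by auto
  next
    case (eng h1 h2)
    then show ?case by (metis funpow_add galois_group_mult)
  qed
  then have "\<exists>i<N. \<tau> = \<sigma> ^^ i" if "\<tau> \<in> carrier (galois_group \<iota>)" for \<tau>
    using that gen mod mod_less_divisor[OF N(1)] by metis
  then have "bij_betw (\<lambda>i. \<sigma> ^^ i) {..<N} (carrier (galois_group \<iota>))"
    using inj pow by (auto simp: bij_betw_def)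
  then show ?thesis using N that by blast
qed

section \<open>Quadratic extensions\<close>

text \<open>1 and \<open>\<theta>\<close> are independent and extend to a basis; the basis has two
  elements, so nothing was added.\<close>

lemma quadratic_decomposition:
  assumes "field_hom j" "ext_degree j = 2" "\<theta> \<notin> range j"
  shows "\<exists>a b. x = j a + \<theta> * j b"
proof -
  interpret j: field_hom j by fact
  interpret V: vector_space "\<lambda>k a. j k * a" by (rule vector_space_field_hom) fact
  have "1 \<noteq> \<theta>" using assms(3) by (metis j.hom_one rangeI)
  have span1: "V.span {1} = range j" by (auto simp: V.span_singleton)
  then have "V.independent {\<theta>, 1}"
    using assms(3) by (intro V.independent_insertI) (simp_all add: V.independent_empty)
  then have "V.independent {1, \<theta>}" by (simp add: insert_commute)
  then obtain B where B: "{1, \<theta>} \<subseteq> B" "V.independent B" "UNIV \<subseteq> V.span B"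
    using V.maximal_independent_subset_extend[of "{1, \<theta>}" UNIV] by auto
  then have "card B = 2"
    using V.basis_card_eq_dim[of B UNIV] assms(2) by (simp add: ext_degree_def)
  then have "{1, \<theta>} = B"
    using B(1) \<open>1 \<noteq> \<theta>\<close> by (intro card_subset_eq) (auto intro: card_ge_0_finite)
  then have "x \<in> V.span {\<theta>, 1}" using B(3) by (auto simp: insert_commute)
  then obtain b where "x - j b * \<theta> \<in> V.span {1}" by (auto simp: V.span_insert)
  then obtain a where "x - j b * \<theta> = j a" by (auto simp: span1)
  then show ?thesis by (intro exI[of _ a] exI[of _ b]) (simp add: algebra_simps)
qed

lemma quadratic_decomposition_unique:
  assumes "field_hom j" "\<theta> \<notin> range j" "j a + \<theta> * j b = j c + \<theta> * j d"
  shows "a = c" "b = d"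
proof -
  interpret j: field_hom j by fact
  have eq: "\<theta> * j (b - d) = j (c - a)"
    using assms(3) by (simp add: j.hom_minus algebra_simps)
  show "b = d"
  proof (rule ccontr)
    assume "b \<noteq> d"
    then have "\<theta> = j (c - a) / j (b - d)"
      using eq by (simp add: nonzero_eq_divide_eq)
    also have "\<dots> = j ((c - a) * inverse (b - d))"
      by (simp add: divide_inverse j.hom_mult j.hom_inverse)
    finally have "\<theta> = j ((c - a) * inverse (b - d))" .
    then show False using assms(2) by blast
  qed
  then show "a = c" using eq by simp
qed

text \<open>\<open>j p - \<theta>\<close> is the second root of X^2 - p X - q, so replacing
  \<open>\<theta>\<close> by it respects sums and products. The map may still be the identity;
  separability enters separately.\<close>

lemma quadratic_conjugation_exists:
  assumes j: "field_hom j" and deg: "ext_degree j = 2" and \<theta>: "\<theta> \<notin> range j"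
    and sq: "\<theta> * \<theta> = \<theta> * j p + j q"
  obtains \<tau> where "field_hom \<tau>" "bij \<tau>" "\<tau> \<circ> \<tau> = id" "\<And>a. \<tau> (j a) = j a" "\<tau> \<theta> = j p - \<theta>"
proof -
  interpret j: field_hom j by fact
  have "\<exists>a b. x = j a + \<theta> * j b" for x
    using quadratic_decomposition assms by blast
  then obtain A B where AB: "\<And>x. x = j (A x) + \<theta> * j (B x)" by metis
  define \<tau> where "\<tau> x = j (A x) + (j p - \<theta>) * j (B x)" for x
  have \<tau>: "\<tau> (j a + \<theta> * j b) = j a + (j p - \<theta>) * j b" for a b
    using quadratic_decomposition_unique[OF j \<theta> AB[of "j a + \<theta> * j b", symmetric]]
    by (simp add: \<tau>_def)
  have \<tau>j: "\<tau> (j a) = j a" for a using \<tau>[of a 0] by simp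
  have hom: "field_hom \<tau>"
  proof unfold_locales
    show "\<tau> 0 = 0" "\<tau> 1 = 1" using \<tau>j[of 0] \<tau>j[of 1] by simp_all
  next
    fix x y
    have "x + y = j (A x + A y) + \<theta> * j (B x + B y)"
      by (subst (1) AB[of x], subst (1) AB[of y]) (simp add: j.hom_add algebra_simps)
    then show "\<tau> (x + y) = \<tau> x + \<tau> y"
      by (simp only: \<tau>) (simp add: \<tau>_def j.hom_add algebra_simps)
    have "x * y = j (A x) * j (A y) + \<theta> * (j (A x) * j (B y) + j (B x) * j (A y))
        + (\<theta> * \<theta>) * (j (B x) * j (B y))"
      by (subst (1) AB[of x], subst (1) AB[of y]) (simp add: algebra_simps)
    also have "\<dots> = j (A x * A y + q * (B x * B y)) + \<theta> * j (A x * B y + B x * A y + p * (B x * B y))"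
      unfolding sq by (simp add: j.hom_add j.hom_mult algebra_simps)
    finally have "\<tau> (x * y) = j (A x * A y + q * (B x * B y))
        + (j p - \<theta>) * j (A x * B y + B x * A y + p * (B x * B y))"
      by (simp only: \<tau>)
    also have "\<dots> = j (A x) * j (A y) + (j p - \<theta>) * (j (A x) * j (B y) + j (B x) * j (A y))
        + (j p * j p - j p * \<theta> + j q) * (j (B x) * j (B y))"
      by (simp add: j.hom_add j.hom_mult algebra_simps)
    \<comment> \<open>This is the quadratic equation for the second root.\<close>
    also have "j p * j p - j p * \<theta> + j q = (j p - \<theta>) * (j p - \<theta>)"
      using sq by (simp add: algebra_simps)
    finally show "\<tau> (x * y) = \<tau> x * \<tau> y"
      by (simp add: \<tau>_def algebra_simps)
  qed
  have "\<tau> (\<tau> x) = x" for x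
  proof -
    have "\<tau> x = j (A x + p * B x) + \<theta> * j (- B x)"
      by (simp add: \<tau>_def j.hom_add j.hom_mult j.hom_uminus algebra_simps)
    then have "\<tau> (\<tau> x) = j (A x + p * B x) + (j p - \<theta>) * j (- B x)" by (simp only: \<tau>)
    also have "\<dots> = j (A x) + \<theta> * j (B x)"
      by (simp add: j.hom_add j.hom_mult j.hom_uminus algebra_simps)
    finally show ?thesis using AB by simp
  qed
  then have inv: "\<tau> \<circ> \<tau> = id" by (simp add: fun_eq_iff)
  show ?thesis
    using that[OF hom o_bij[OF inv inv] inv \<tau>j] \<tau>[of 0 1] by simp
qed

text \<open>
  Otherwise \<open>(X - \<theta>)\<^sup>2\<close> would have coefficients in \<open>range j\<close> and divide the separable orbit polynomial
  of \<open>\<theta>\<close>.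
\<close>

lemma quadratic_conjugation_nontrivial:
  assumes j: "field_hom j" and sub: "range \<iota> \<subseteq> range j"
    and fixed: "{a. \<forall>\<tau> \<in> carrier (galois_group \<iota>). \<tau> a = a} = range \<iota>"
    and fin: "finite (carrier (galois_group \<iota>))"
    and \<theta>: "\<theta> \<notin> range j" and sq: "\<theta> * \<theta> = \<theta> * j p + j q"
  shows "j p - \<theta> \<noteq> \<theta>"
proof
  assume eq: "j p - \<theta> = \<theta>"
  interpret j: field_hom j by fact
  interpret G: group "galois_group \<iota>" by (rule group_galois_group)
  interpret jp: map_poly_comm_ring_hom j ..
  define R where "R = (\<lambda>\<tau>. \<tau> \<theta>) ` carrier (galois_group \<iota>)"
  define g where "g = (\<Prod>\<rho>\<in>R. [:- \<rho>, 1:])"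
  have "finite R" using fin by (simp add: R_def)
  have "id \<in> carrier (galois_group \<iota>)" using G.one_closed by simp
  then have "\<theta> \<in> R" unfolding R_def by (intro image_eqI[of _ _ id]) simp_all
  \<comment> \<open>Each automorphism permutes the orbit \<open>R\<close>, hence the linear factors
    of \<open>g\<close>. The coefficients of \<open>g\<close> are therefore fixed by the group and
    lie in \<open>range \<iota>\<close>.\<close>
  have inv: "map_poly \<tau> g = g" if \<tau>: "\<tau> \<in> carrier (galois_group \<iota>)" for \<tau>
  proof -
    interpret \<tau>: field_hom \<tau> using \<tau> by (simp add: galois_group_def)
    interpret \<tau>p: map_poly_comm_ring_hom \<tau> ..
    have "\<tau> ` R = (\<lambda>\<rho>. \<rho> \<theta>) ` ((\<lambda>\<rho>. \<tau> \<circ> \<rho>) ` carrier (galois_group \<iota>))"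
      by (auto simp: R_def image_image)
    also have "\<dots> = R"
      using galois_group_bij_betw_comp(1)[OF \<tau>] by (simp add: bij_betw_def R_def)
    finally have "bij_betw \<tau> R R"
      by (auto simp: bij_betw_def intro: inj_onI)
    have "map_poly \<tau> g = (\<Prod>\<rho>\<in>R. map_poly \<tau> [:- \<rho>, 1:])"
      by (simp add: g_def \<tau>p.hom_prod)
    also have "\<dots> = (\<Prod>\<rho>\<in>R. [:- \<tau> \<rho>, 1:])"
      by (simp add: \<tau>.map_poly_pCons_hom \<tau>.hom_uminus)
    also have "\<dots> = g"
      unfolding g_def using \<open>bij_betw \<tau> R R\<close> by (rule prod.reindex_bij_betw)
    finally show ?thesis .
  qed
  have "coeff g i \<in> range \<iota>" for i
  proof -
    have "\<tau> (coeff g i) = coeff g i" if \<tau>: "\<tau> \<in> carrier (galois_group \<iota>)" for \<tau>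
    proof -
      interpret \<tau>: field_hom \<tau> using \<tau> by (simp add: galois_group_def)
      show ?thesis using arg_cong[OF inv[OF \<tau>], of "\<lambda>p. coeff p i"] by simp
    qed
    then show ?thesis by (simp flip: fixed)
  qed
  then have rng: "coeff g i \<in> range j" for i using sub by blast
  define h where "h = map_poly (inv_into UNIV j) g"
  have "inv_into UNIV j 0 = 0" by (metis inv_f_f j.hom_zero j.inj_f)
  then have h: "map_poly j h = g"
    using rng by (simp add: h_def poly_eq_iff coeff_map_poly f_inv_into_f)
  \<comment> \<open>By the assumption \<open>j p\<close> is twice \<open>\<theta>\<close>, so over
    the large field this quadratic becomes the square of X - \<open>\<theta>\<close>.\<close>
  define \<mu> where "\<mu> = [:- q, - p, 1:]"
  have "j p = \<theta> + \<theta>" using eq by (simp add: algebra_simps)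
  then have \<mu>: "map_poly j \<mu> = [:- \<theta>, 1:] * [:- \<theta>, 1:]"
    using sq by (simp add: \<mu>_def j.map_poly_pCons_hom j.hom_uminus algebra_simps
        eq_neg_iff_add_eq_0 neg_eq_iff_add_eq_0)
  have "degree \<mu> = 2" by (simp add: \<mu>_def)
  have "h mod \<mu> = 0 \<or> degree (h mod \<mu>) < 2"
    using degree_mod_less[of \<mu> h] \<open>degree \<mu> = 2\<close> by fastforce
  then have "degree (h mod \<mu>) < 2" by auto
  then obtain a b where ab: "h mod \<mu> = [:a, b:]"
    by (cases "h mod \<mu>" rule: pCons_cases) (auto elim!: degree_eq_zeroE split: if_splits)
  have "g = map_poly j (h div \<mu> * \<mu> + h mod \<mu>)"
    by (simp add: h)
  also have "\<dots> = map_poly j (h div \<mu>) * ([:- \<theta>, 1:] * [:- \<theta>, 1:]) + [:j a, j b:]"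
    by (simp only: j.map_poly_hom_add jp.hom_mult \<mu> ab) (simp add: j.map_poly_pCons_hom)
  finally have g: "g = map_poly j (h div \<mu>) * ([:- \<theta>, 1:] * [:- \<theta>, 1:]) + [:j a, j b:]" .
  have g': "g = [:- \<theta>, 1:] * (\<Prod>\<rho>\<in>R - {\<theta>}. [:- \<rho>, 1:])"
    unfolding g_def using \<open>finite R\<close> \<open>\<theta> \<in> R\<close> by (rule prod.remove)
  \<comment> \<open>Evaluation at \<open>\<theta>\<close> kills the multiple of the square; the
    linear remainder must vanish there too, and uniqueness of coordinates makes both of its
    coefficients 0.\<close>
  have "poly g \<theta> = 0" unfolding g' by simp
  then have "j a + \<theta> * j b = j 0 + \<theta> * j 0" by (simp add: g)
  then have "a = 0" "b = 0" using quadratic_decomposition_unique[OF j \<theta>] by blast+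
  then have "[:j a, j b:] = 0" by simp
  then have "g = map_poly j (h div \<mu>) * ([:- \<theta>, 1:] * [:- \<theta>, 1:])"
    by (simp only: g add_0_right)
  also have "\<dots> = [:- \<theta>, 1:] * (map_poly j (h div \<mu>) * [:- \<theta>, 1:])"
    by (rule mult.left_commute)
  finally have "[:- \<theta>, 1:] * (\<Prod>\<rho>\<in>R - {\<theta>}. [:- \<rho>, 1:])
      = [:- \<theta>, 1:] * (map_poly j (h div \<mu>) * [:- \<theta>, 1:])"
    unfolding g' .
  then have "(\<Prod>\<rho>\<in>R - {\<theta>}. [:- \<rho>, 1:]) = map_poly j (h div \<mu>) * [:- \<theta>, 1:]"
    by (subst (asm) mult_cancel_left) simp
  \<comment> \<open>After cancelling one factor, \<open>\<theta>\<close> would be a root of the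
    product over the other orbit elements, each factor of which is nonzero at
    \<open>\<theta>\<close>.\<close>
  then have "poly (\<Prod>\<rho>\<in>R - {\<theta>}. [:- \<rho>, 1:]) \<theta> = 0" by simp
  then show False using \<open>finite R\<close> by (simp add: poly_prod)
qed

text \<open>
  With \<open>|G| = 2k\<close>, the nontrivial automorphism over \<open>range j\<close> is \<open>\<sigma>\<^sup>k\<close>, and the product of the
  \<open>\<sigma>\<^sup>i e\<close> over \<open>i < k\<close> is the norm of \<open>e\<close> from \<open>range j\<close> to \<open>range \<iota>\<close>.
\<close>

lemma galois_norm_quadratic_subfield:
  assumes cyc: "cyclic_galois_extension \<iota> \<sigma>" and j: "field_hom j"
    and sub: "range \<iota> \<subseteq> range j" and deg: "ext_degree j = 2"
    and fin: "finite (carrier (galois_group \<iota>))" and e: "e \<in> range j"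
    and \<theta>: "\<theta> \<notin> range j"
  shows "\<exists>c. galois_norm \<iota> e = \<iota> (c\<^sup>2)"
proof -
  interpret j: field_hom j by fact
  have \<sigma>: "\<sigma> \<in> carrier (galois_group \<iota>)"
    and gen: "generate (galois_group \<iota>) {\<sigma>} = carrier (galois_group \<iota>)"
    and fixed: "{a. \<forall>\<tau> \<in> carrier (galois_group \<iota>). \<tau> a = a} = range \<iota>"
    and \<iota>: "field_hom \<iota>"
    using cyc by (auto simp: cyclic_galois_extension_def galois_extension_def)
  interpret \<iota>: field_hom \<iota> by fact
  interpret \<sigma>: field_hom \<sigma> using \<sigma> by (simp add: galois_group_def)
  obtain p q where "\<theta> * \<theta> = j q + \<theta> * j p"
    using quadratic_decomposition[OF j deg \<theta>] by blast
  then have sq: "\<theta> * \<theta> = \<theta> * j p + j q" by simp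
  obtain \<tau> where \<tau>: "field_hom \<tau>" "bij \<tau>" "\<tau> \<circ> \<tau> = id" "\<And>a. \<tau> (j a) = j a" "\<tau> \<theta> = j p - \<theta>"
    using quadratic_conjugation_exists[OF j deg \<theta> sq] by blast
  have "\<tau> (\<iota> a) = \<iota> a" for a
    using \<tau>(4) sub by (metis range_eqI rangeE subsetD)
  then have "\<tau> \<in> carrier (galois_group \<iota>)"
    using \<tau> by (simp add: galois_group_def)
  obtain N where N: "0 < N" "\<sigma> ^^ N = id"
    "bij_betw (\<lambda>i. \<sigma> ^^ i) {..<N} (carrier (galois_group \<iota>))"
    using cyclic_galois_group_enum[OF \<sigma> gen fin] by blast
  then obtain k where k: "k < N" "\<tau> = \<sigma> ^^ k"
    using \<open>\<tau> \<in> _\<close> by (force simp: bij_betw_def)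
  have inj: "a = b" if "a < N" "b < N" "\<sigma> ^^ a = \<sigma> ^^ b" for a b
    using N(3) that by (auto simp: bij_betw_def inj_on_def)
  have "\<tau> \<noteq> id"
    using quadratic_conjugation_nontrivial[OF j sub fixed fin \<theta> sq] \<tau>(5) by auto
  then have "0 < k" using k by (cases k) auto
  have kk: "\<sigma> ^^ (k + k) = id" using \<tau>(3) k by (simp add: funpow_add)
  \<comment> \<open>\<open>\<tau>\<close> is an involution with \<open>0 < k < N\<close>, so
    \<open>k + k\<close> is a positive multiple of \<open>N\<close> below 2N.\<close>
  have "N = k + k"
  proof (cases "k + k < N")
    case True
    then show ?thesis using inj[of "k + k" 0] kk \<open>0 < k\<close> by simp
  next
    case False
    then have "\<sigma> ^^ (k + k - N) = id"
      using kk N(2) funpow_add[of "k + k - N" N \<sigma>] by simp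
    then show ?thesis using inj[of "k + k - N" 0] False k N(1) by fastforce
  qed
  have \<tau>e: "(\<sigma> ^^ k) e = e" using \<tau>(4) e k by auto
  define w where "w = (\<Prod>i<k. (\<sigma> ^^ i) e)"
  have split: "(\<Prod>i<k + m. (\<sigma> ^^ i) e) = w * (\<Prod>i<m. (\<sigma> ^^ (k + i)) e)" for m
    unfolding w_def by (induction m) (simp_all add: mult.assoc)
  have "galois_norm \<iota> e = (\<Prod>i<k + k. (\<sigma> ^^ i) e)"
    using prod.reindex_bij_betw[OF N(3), of "\<lambda>\<tau>. \<tau> e"] \<open>N = k + k\<close>
    by (simp add: galois_norm_def)
  also have "\<dots> = w * (\<Prod>i<k. (\<sigma> ^^ (k + i)) e)"
    by (rule split)
  also have "(\<Prod>i<k. (\<sigma> ^^ (k + i)) e) = w"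
    unfolding w_def by (intro prod.cong) (simp_all add: add.commute[of k] funpow_add \<tau>e)
  finally have norm: "galois_norm \<iota> e = w * w" .
  obtain m where m: "k = Suc m" using \<open>0 < k\<close> by (cases k) auto
  \<comment> \<open>\<open>\<sigma>\<close> shifts the factors of \<open>w\<close> by one; the new
    factor \<open>(\<sigma> ^^ k) e\<close> equals the lost factor \<open>e\<close>.\<close>
  have "\<sigma> w = (\<Prod>i<Suc m. (\<sigma> ^^ Suc i) e)"
    unfolding w_def m by (simp add: \<sigma>.hom_prod \<sigma>.hom_mult)
  also have "\<dots> = w"
    unfolding w_def m using \<tau>e m by (subst (2) prod.lessThan_Suc_shift) (simp add: mult.commute)
  finally have "\<sigma> w = w" .
  then have "(\<sigma> ^^ i) w = w" for i by (induction i) simp_all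
  then have "\<forall>\<rho>\<in>(\<lambda>i. \<sigma> ^^ i) ` {..<N}. \<rho> w = w" by auto
  then have "\<rho> w = w" if "\<rho> \<in> carrier (galois_group \<iota>)" for \<rho>
    using bij_betw_imp_surj_on[OF N(3)] that by simp
  then obtain c where "w = \<iota> c" using fixed by blast
  then show ?thesis using norm by (intro exI[of _ c]) (simp add: power2_eq_square \<iota>.hom_mult)
qed

section \<open>Linear algebra\<close>

text \<open>A basis of \<open>A\<close> is mapped to an independent set of the same size, and a
  vector outside its span would enlarge it beyond the dimension. The count stays inside
  \<open>A\<close> because the ambient space may be infinite-dimensional.\<close>

lemma (in vector_space) bij_betw_linear_inj_on_subspace:
  assumes A: "subspace A" "finite B" "span B = A"
    and h: "Vector_Spaces.linear scale scale h" "h ` A \<subseteq> A"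
    and inj: "\<And>a. a \<in> A \<Longrightarrow> h a = 0 \<Longrightarrow> a = 0"
  shows "bij_betw h A A"
proof -
  interpret pair: vector_space_pair scale scale ..
  obtain C where C: "C \<subseteq> A" "independent C" "A \<subseteq> span C"
    using maximal_independent_subset[of A] by blast
  have span: "span C = A" using C A(1) span_minimal by blast
  have fin: "finite C" using independent_span_bound[OF A(2) C(2)] A(3) C(1) by simp
  have inj_on: "inj_on h A"
    using pair.linear_inj_on_iff_eq_0[OF h(1) A(1)] inj by auto
  have ind: "independent (h ` C)"
    using pair.linear_independent_injective_image[OF h(1) C(2)] inj_on span by simp
  have card: "card (h ` C) = card C"
    using inj_on C(1) by (intro card_image) (rule inj_on_subset)
  have "A \<subseteq> span (h ` C)"
  proof
    fix v assume "v \<in> A"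
    show "v \<in> span (h ` C)"
    proof (rule ccontr)
      assume v: "v \<notin> span (h ` C)"
      then have "independent (insert v (h ` C))"
        using ind by (rule independent_insertI)
      moreover have "insert v (h ` C) \<subseteq> span C"
        unfolding span using \<open>v \<in> A\<close> h(2) C(1) by blast
      ultimately have "card (insert v (h ` C)) \<le> card C"
        by (rule independent_span_bound[OF fin, THEN conjunct2])
      moreover have "v \<notin> h ` C" using v span_base by metis
      ultimately show False using card fin by simp
    qed
  qed
  moreover have "span (h ` C) = h ` A"
    using pair.linear_span_image[OF h(1)] span by simp
  ultimately show ?thesis using inj_on h(2) by (auto simp: bij_betw_def)
qed

lemma vector_space_smult_poly:
  assumes "field_hom \<iota>"
  shows "vector_space (\<lambda>k. Polynomial.smult (\<iota> k))"
proof -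
  interpret field_hom \<iota> by fact
  show ?thesis by unfold_locales (auto simp: hom_add hom_mult smult_add_right smult_add_left)
qed

lemma finite_basis_exists:
  assumes "field_hom \<iota>" "0 < ext_degree \<iota>"
  obtains B where "finite B" "module.span (\<lambda>k a. \<iota> k * a) B = UNIV"
    "\<not> module.dependent (\<lambda>k a. \<iota> k * a) B" "card B = ext_degree \<iota>"
proof -
  interpret V: vector_space "\<lambda>k a. \<iota> k * a" by (rule vector_space_field_hom) fact
  obtain B where B: "V.independent B" "UNIV \<subseteq> V.span B" "card B = V.dim UNIV"
    by (rule V.basis_exists)
  then have card: "card B = ext_degree \<iota>" by (simp add: ext_degree_def)
  \<comment> \<open>A positive cardinality excludes infinite sets, whose \<open>card\<close> is
    0.\<close>
  then have "finite B" using assms(2) by (intro card_ge_0_finite) simp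
  moreover have "V.span B = UNIV" using B(2) by (simp add: top.extremum_unique)
  ultimately show ?thesis using B(1) card by (rule that)
qed

text \<open>The basis consists of the monomials b x^i with \<open>b\<close> in a basis of the field
  extension and \<open>i < d\<close>.\<close>

lemma degree_less_basis:
  assumes \<iota>: "field_hom \<iota>" and pos: "0 < ext_degree \<iota>" "0 < d"
  shows "\<exists>B. finite B \<and> card B = ext_degree \<iota> * d \<and>
    \<not> module.dependent (\<lambda>k. Polynomial.smult (\<iota> k)) B \<and>
    module.span (\<lambda>k. Polynomial.smult (\<iota> k)) B = {p :: 'l::field poly. degree p < d}"
proof -
  interpret \<iota>: field_hom \<iota> by fact
  interpret V: vector_space "\<lambda>k a. \<iota> k * a" by (rule vector_space_field_hom) fact
  interpret P: vector_space "\<lambda>k. Polynomial.smult (\<iota> k)" by (rule vector_space_smult_poly) fact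
  interpret VP: vector_space_pair "\<lambda>k a. \<iota> k * a" "\<lambda>k. Polynomial.smult (\<iota> k)" ..
  obtain B where B: "finite B" "V.span B = UNIV" "V.independent B" "card B = ext_degree \<iota>"
    using finite_basis_exists[OF \<iota> pos(1)] .
  define m where "m = (\<lambda>(b::'l, i). Polynomial.monom b i)"
  define M where "M = m ` (B \<times> {..<d})"
  have nz: "b \<noteq> 0" if "b \<in> B" for b using that B(3) V.dependent_zero[of B] by auto
  have inj: "inj_on m (B \<times> {..<d})"
  proof (rule inj_onI, clarify)
    fix b i c k assume *: "b \<in> B" "c \<in> B" "m (b, i) = m (c, k)"
    then have "degree (Polynomial.monom b i) = degree (Polynomial.monom c k)"
      by (simp add: m_def)
    then have "i = k" using nz * by (simp add: degree_monom_eq)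
    then show "b = c \<and> i = k" using * by (simp add: m_def monom_eq_iff)
  qed
  have fin: "finite M" using B(1) by (simp add: M_def)
  have card: "card M = ext_degree \<iota> * d"
    unfolding M_def using inj B(4) by (simp add: card_image card_cartesian_product)
  have "P.independent M"
  proof (rule P.independent_if_scalars_zero[OF fin])
    fix u x assume sum: "(\<Sum>x\<in>M. Polynomial.smult (\<iota> (u x)) x) = 0" and "x \<in> M"
    then obtain b i where x: "x = m (b, i)" "b \<in> B" "i < d" by (auto simp: M_def)
    \<comment> \<open>Coefficient \<open>i\<close> only sees the monomials of exponent
      \<open>i\<close>, which reduces the claim to independence of \<open>B\<close>.\<close>
    have "0 = coeff (\<Sum>x\<in>M. Polynomial.smult (\<iota> (u x)) x) i" by (simp add: sum)
    also have "\<dots> = (\<Sum>x\<in>M. \<iota> (u x) * coeff x i)" by (simp add: coeff_sum)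
    also have "\<dots> = (\<Sum>y\<in>B \<times> {..<d}. \<iota> (u (m y)) * coeff (m y) i)"
      unfolding M_def by (simp add: sum.reindex[OF inj])
    also have "\<dots> = (\<Sum>c\<in>B. \<Sum>k<d. \<iota> (u (m (c, k))) * coeff (m (c, k)) i)"
      by (simp add: sum.cartesian_product case_prod_beta)
    also have "\<dots> = (\<Sum>c\<in>B. \<Sum>k<d. if k = i then \<iota> (u (m (c, i))) * c else 0)"
      by (intro sum.cong) (auto simp: m_def)
    also have "\<dots> = (\<Sum>c\<in>B. \<iota> (u (m (c, i))) * c)" using x by simp
    finally show "u x = 0"
      using V.independentD[OF B(3) B(1) order_refl, of "\<lambda>c. u (m (c, i))" b] x by simp
  qed
  moreover have "P.span M = {p. degree p < d}"
  proof
    have "P.subspace {p. degree p < d}"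
      using pos(2) by (simp add: P.subspace_def degree_add_less le_less_trans[OF degree_smult_le])
    moreover have "M \<subseteq> {p. degree p < d}"
      by (auto simp: M_def m_def intro: le_less_trans[OF degree_monom_le])
    ultimately show "P.span M \<subseteq> {p. degree p < d}" by (rule P.span_minimal[rotated])
  next
    have mon: "Polynomial.monom a i \<in> P.span M" if "i < d" for a i
    proof -
      have lin: "Vector_Spaces.linear (\<lambda>k a. \<iota> k * a) (\<lambda>k. Polynomial.smult (\<iota> k))
          (\<lambda>a. Polynomial.monom a i)"
        using V.vector_space_axioms P.vector_space_axioms
        by (simp add: Vector_Spaces.linear_iff add_monom smult_monom)
      have "Polynomial.monom a i \<in> (\<lambda>a. Polynomial.monom a i) ` V.span B" by (simp add: B(2))
      also have "\<dots> = P.span ((\<lambda>a. Polynomial.monom a i) ` B)"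
        by (rule VP.linear_span_image[OF lin, symmetric])
      finally have mem: "Polynomial.monom a i \<in> P.span ((\<lambda>a. Polynomial.monom a i) ` B)" .
      have "(\<lambda>a. Polynomial.monom a i) ` B \<subseteq> M"
      proof
        fix x assume "x \<in> (\<lambda>a. Polynomial.monom a i) ` B"
        then obtain b where "b \<in> B" "x = m (b, i)" by (auto simp: m_def)
        then show "x \<in> M" using that by (simp add: M_def)
      qed
      then have "P.span ((\<lambda>a. Polynomial.monom a i) ` B) \<subseteq> P.span M" by (rule P.span_mono)
      then show ?thesis using mem by (rule subsetD)
    qed
    show "{p. degree p < d} \<subseteq> P.span M"
    proof clarify
      fix p :: "'l poly" assume "degree p < d"
      then have "(\<Sum>i\<le>degree p. Polynomial.monom (coeff p i) i) \<in> P.span M"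
        by (intro P.span_sum mon) auto
      then show "p \<in> P.span M" by (simp only: poly_as_sum_of_monoms)
    qed
  qed
  ultimately show ?thesis using fin card by blast
qed

section \<open>The component along \<open>\<gamma>\<close>\<close>

lemma gamma_component_eqI:
  assumes "field_hom j" "\<gamma> \<notin> range j"
  shows "gamma_component (range j) \<gamma> (j a + \<gamma> * j b) = j b"
  unfolding gamma_component_def
  using quadratic_decomposition_unique(2)[OF assms] by (intro the_equality) auto

lemma gamma_component_decomposition:
  assumes "field_hom j" "ext_degree j = 2" "\<gamma> \<notin> range j"
  obtains a b where "x = j a + \<gamma> * j b" "gamma_component (range j) \<gamma> x = j b"
  using quadratic_decomposition[OF assms, of x] gamma_component_eqI[OF assms(1,3)] by metis

lemma gamma_component_add:
  assumes "field_hom j" "ext_degree j = 2" "\<gamma> \<notin> range j"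
  shows "gamma_component (range j) \<gamma> (x + y) =
    gamma_component (range j) \<gamma> x + gamma_component (range j) \<gamma> y"
proof -
  interpret j: field_hom j by fact
  obtain a b c d where *: "x = j a + \<gamma> * j b" "gamma_component (range j) \<gamma> x = j b"
    "y = j c + \<gamma> * j d" "gamma_component (range j) \<gamma> y = j d"
    using gamma_component_decomposition[OF assms] by metis
  then have "x + y = j (a + c) + \<gamma> * j (b + d)" by (simp add: j.hom_add algebra_simps)
  then have "gamma_component (range j) \<gamma> (x + y) = j (b + d)"
    by (simp only: gamma_component_eqI[OF assms(1,3)])
  then show ?thesis using * by (simp add: j.hom_add)
qed

text \<open>Multiplying both coordinates by an element of \<open>range j\<close> stays within
  \<open>range j\<close>. Base field scalars are covered, since \<open>range \<iota>\<close> is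
  contained in \<open>range j\<close>.\<close>

lemma gamma_component_scale:
  assumes "field_hom j" "ext_degree j = 2" "\<gamma> \<notin> range j" "k \<in> range j"
  shows "gamma_component (range j) \<gamma> (k * x) = k * gamma_component (range j) \<gamma> x"
proof -
  interpret j: field_hom j by fact
  obtain a b where *: "x = j a + \<gamma> * j b" "gamma_component (range j) \<gamma> x = j b"
    using gamma_component_decomposition[OF assms(1-3)] by metis
  obtain c where c: "k = j c" using assms(4) by blast
  have "k * x = j (c * a) + \<gamma> * j (c * b)" using * c by (simp add: j.hom_mult algebra_simps)
  then have "gamma_component (range j) \<gamma> (k * x) = j (c * b)"
    by (simp only: gamma_component_eqI[OF assms(1,3)])
  then show ?thesis using * c by (simp add: j.hom_mult)
qed

section \<open>The division algebra\<close>

theorem mainTheorem16: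
  fixes \<iota> :: "'k::field \<Rightarrow> 'l::field"
    and j :: "'m::field \<Rightarrow> 'l"
    and \<sigma> :: "'l \<Rightarrow> 'l"
    and f :: "'l poly"
    and F :: "'k poly"
    and \<gamma> :: 'l
    and n t s l :: nat
  assumes "cyclic_galois_extension \<iota> \<sigma>"
    and "ext_degree \<iota> = n"
    and "n = 2 * t"
    and "field_hom j"
    and "range \<iota> \<subseteq> range j"
    and "ext_degree j = 2"
    and "lead_coeff f = 1"
    and "skew_irreducible \<sigma> f"
    and "f \<notin> skew_center \<sigma>"
    and "lead_coeff F = 1"
    and "irreducible F"
    and "degree F = s"
    and "F \<noteq> [:0, 1:]"
    and "is_skew_bound \<sigma> f (subst_power \<iota> n F)"
    and "l = skew_ell \<iota> \<sigma> F"
    and "degree f = s * l"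
    and "\<gamma> / coeff f 0 \<notin> range j"
    and "\<nexists>c. galois_norm \<iota> \<gamma> = \<iota> (c\<^sup>2)"
  shows "unital_division_algebra_on (\<lambda>k. Polynomial.smult (\<iota> k)) {p. degree p < s * l}
           (star_D \<sigma> (range j) \<gamma> f) 1 \<and>
         vector_space.dim (\<lambda>k. Polynomial.smult (\<iota> k)) {p. degree p < s * l} = n * s * l"
proof -
  note cyc = assms(1) and j = assms(4) and sub = assms(5) and deg_j = assms(6)
    and monic = assms(7) and irred = assms(8) and \<gamma>_f0 = assms(17) and norm_nonsq = assms(18)
  have \<sigma>: "\<sigma> \<in> carrier (galois_group \<iota>)" and \<iota>: "field_hom \<iota>" and n_pos: "0 < ext_degree \<iota>"
    using cyc by (auto simp: cyclic_galois_extension_def galois_extension_def)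
  interpret \<iota>: field_hom \<iota> by fact
  interpret j: field_hom j by fact
  interpret skew_poly \<sigma> using \<sigma> by (simp add: skew_poly_def galois_group_def)
  interpret P: vector_space "\<lambda>k. Polynomial.smult (\<iota> k)" by (rule vector_space_smult_poly) fact
  have \<sigma>\<iota>: "\<sigma> (\<iota> k) = \<iota> k" for k using \<sigma> by (simp add: galois_group_def)
  define d where "d = s * l"
  have deg: "degree f = d" using assms(16) by (simp add: d_def)
  have d: "0 < d" using skew_irreducible_degree_pos[OF irred] deg by simp
  have "f \<noteq> 0" using monic by auto
  define A where "A = {p :: 'l poly. degree p < d}"
  \<comment> \<open>\<open>degree 0 = 0\<close> and \<open>0 < d\<close>, so the two ways of
    bounding a remainder agree.\<close>
  have A_iff: "p \<in> A \<longleftrightarrow> p = 0 \<or> degree p < degree f" for p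
    using d by (auto simp: A_def deg)
  obtain B where B: "finite B" "card B = ext_degree \<iota> * d" "P.independent B" "P.span B = A"
    using degree_less_basis[OF \<iota> n_pos d] unfolding A_def by blast
  have subspace: "P.subspace A" using B(4) P.subspace_span by metis
  have dim: "P.dim A = n * s * l"
    using P.dim_eq_card_independent[OF B(3)] B(2,4) assms(2) P.dim_span[of B] by (simp add: d_def)

  \<comment> \<open>Division by 0 yields 0, which lies in \<open>range j\<close>.\<close>
  have f0: "coeff f 0 \<noteq> 0"
  proof
    assume "coeff f 0 = 0"
    then have "\<gamma> / coeff f 0 = j 0" by simp
    then show False using \<gamma>_f0 by blast
  qed
  \<comment> \<open>For an infinite group the norm would be 1 by convention, a square.\<close>
  have "finite (carrier (galois_group \<iota>))"
  proof (rule ccontr)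
    assume "\<not> ?thesis"
    then have "galois_norm \<iota> \<gamma> = \<iota> (1\<^sup>2)" by (simp add: galois_norm_def)
    then show False using norm_nonsq by blast
  qed
  then have square: "\<exists>c. galois_norm \<iota> e = \<iota> (c\<^sup>2)" if "e \<in> range j" for e
    using galois_norm_quadratic_subfield[OF cyc j sub deg_j _ that \<gamma>_f0] by blast
  \<comment> \<open>Norms from \<open>range j\<close> are squares, unlike that of
    \<open>\<gamma>\<close>. Hence \<open>\<gamma>\<close> itself can serve as second basis element
    over \<open>range j\<close>.\<close>
  have \<gamma>: "\<gamma> \<notin> range j" using square norm_nonsq by blast
  have "\<gamma> \<noteq> 0" using \<gamma> by (metis j.hom_zero rangeI)

  \<comment> \<open>Bilinearity and closure of the product\<close>
  define G where "G a = gamma_component (range j) \<gamma> (coeff a 0)" for a :: "'l poly"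
  define T where "T a = a - Polynomial.smult (\<gamma> / coeff f 0 * G a) f" for a
  define pr where "pr = star_D \<sigma> (range j) \<gamma> f"
  have pr: "pr a b = skew_mod \<sigma> (T a \<star> b) f" for a b
    by (simp add: pr_def star_D_def T_def G_def)
  have G_add: "G (a + b) = G a + G b" for a b
    by (simp add: G_def gamma_component_add[OF j deg_j \<gamma>])
  have T_add: "T (a + b) = T a + T b" for a b
    by (simp add: T_def G_add distrib_left smult_add_left)
  have G_scale: "G (Polynomial.smult (\<iota> k) a) = \<iota> k * G a" for k a
    using sub by (simp add: G_def gamma_component_scale[OF j deg_j \<gamma>] image_subset_iff)
  have T_scale: "T (Polynomial.smult (\<iota> k) a) = Polynomial.smult (\<iota> k) (T a)" for k a
    by (simp add: T_def G_scale smult_diff_right mult_ac)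
  have pr_add: "pr (a + b) c = pr a c + pr b c" "pr a (b + c) = pr a b + pr a c" for a b c
    using \<open>f \<noteq> 0\<close> by (simp_all add: pr T_add skew_mult_add_left skew_mult_add_right skew_mod_add)
  have pr_scale: "pr (Polynomial.smult (\<iota> k) a) b = Polynomial.smult (\<iota> k) (pr a b)"
    "pr a (Polynomial.smult (\<iota> k) b) = Polynomial.smult (\<iota> k) (pr a b)" for k a b
    using \<open>f \<noteq> 0\<close> by (simp_all add: pr T_scale skew_mult_smult_left
        skew_mult_smult_fixed_right[OF \<sigma>\<iota>] skew_mod_smult)
  have pr_closed: "pr a b \<in> A" for a b
    using skew_mod_division[OF \<open>f \<noteq> 0\<close>] by (metis A_iff pr)

  \<comment> \<open>Absence of zero divisors\<close>
  have no_zero_div: "a = 0" if a: "a \<in> A" and b: "b \<in> A" "b \<noteq> 0" and zero: "pr a b = 0" for a b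
  proof (rule ccontr)
    assume "a \<noteq> 0"
    obtain q where q: "T a \<star> b = q \<star> f"
      using skew_mod_division[OF \<open>f \<noteq> 0\<close>, of "T a \<star> b"] zero by (metis add_0_right pr)
    obtain u v where uv: "u \<star> b + v \<star> f = 1"
      using skew_irreducible_coprime[OF irred b(2)] b(1) by (auto simp: A_def deg)
    have coeff_d: "coeff (T a) d = - (\<gamma> / coeff f 0 * G a)"
      using a monic deg by (simp add: T_def A_def coeff_eq_0)
    \<comment> \<open>Vanishing in degree \<open>d\<close> forces \<open>G a = 0\<close>, and then
      there is no correction and \<open>T a\<close> is \<open>a\<close>.\<close>
    have "T a \<noteq> 0"
    proof
      assume "T a = 0"
      then have "G a = 0" using coeff_d \<open>\<gamma> \<noteq> 0\<close> f0 by simp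
      then show False using \<open>T a = 0\<close> \<open>a \<noteq> 0\<close> by (simp add: T_def)
    qed
    note * = skew_similar_constant_coeff[where N = "galois_norm \<iota>", OF galois_norm_mult
        galois_norm_invariant[OF \<sigma>] galois_norm_nonzero q uv this \<open>f \<noteq> 0\<close>]
    have "degree (T a) \<le> d"
      using a deg unfolding T_def A_def by (intro degree_diff_le) auto
    \<comment> \<open>The similarity lemma gives the lower bound, the construction of
      \<open>T\<close> the upper one.\<close>
    then have deg_T: "degree (T a) = degree f" using * deg by simp
    then obtain w where w: "coeff (T a) 0 = w * coeff f 0"
      "galois_norm \<iota> w * galois_norm \<iota> 1 = galois_norm \<iota> (- (\<gamma> / coeff f 0 * G a))"
      using * coeff_d deg monic by auto
    have "coeff (T a) d \<noteq> 0" using deg_T deg \<open>T a \<noteq> 0\<close> by (metis leading_coeff_0_iff)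
    then have "G a \<noteq> 0" using coeff_d by auto
    obtain a' a'' where a': "coeff a 0 = j a' + \<gamma> * j a''" "G a = j a''"
      using gamma_component_decomposition[OF j deg_j \<gamma>, of "coeff a 0"] by (metis G_def)
    have "coeff (T a) 0 = j a'" using a' f0 by (simp add: T_def)
    then have "galois_norm \<iota> (j a') = galois_norm \<iota> (w * coeff f 0)" using w(1) by simp
    also have "\<dots> = galois_norm \<iota> w * galois_norm \<iota> 1 * galois_norm \<iota> (coeff f 0)"
      by (simp flip: galois_norm_mult)
    also have "\<dots> = galois_norm \<iota> (- (\<gamma> * j a''))"
      unfolding w(2) using f0 a'(2) by (simp flip: galois_norm_mult)
    \<comment> \<open>Multiplying by the norm of the inverse of \<open>- j a''\<close> isolates the
      norm of \<open>\<gamma>\<close>.\<close>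
    finally have "galois_norm \<iota> (j a' * inverse (- j a'')) =
        galois_norm \<iota> (- (\<gamma> * j a'') * inverse (- j a''))"
      by (simp only: galois_norm_mult)
    also have "- (\<gamma> * j a'') * inverse (- j a'') = \<gamma>" using \<open>G a \<noteq> 0\<close> a'(2) by simp
    finally have "galois_norm \<iota> \<gamma> = galois_norm \<iota> (j (a' * inverse (- a'')))"
      by (simp add: j.hom_mult j.hom_inverse j.hom_uminus)
    then show False using square norm_nonsq by (metis rangeI)
  qed

  \<comment> \<open>Verification of the algebra axioms\<close>
  have "unital_division_algebra_on (\<lambda>k. Polynomial.smult (\<iota> k)) A pr 1"
  proof unfold_locales
    show "P.subspace A" by (rule subspace)
    show "\<exists>B. finite B \<and> P.span B = A" using B by blast
  next
    fix a assume a: "a \<in> A" "a \<noteq> 0"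
    show "bij_betw (\<lambda>b. pr a b) A A"
    proof (rule P.bij_betw_linear_inj_on_subspace[OF subspace B(1,4)])
      show "Vector_Spaces.linear (\<lambda>k. Polynomial.smult (\<iota> k)) (\<lambda>k. Polynomial.smult (\<iota> k)) (\<lambda>b. pr a b)"
        using P.vector_space_axioms by (simp add: Vector_Spaces.linear_iff pr_add(2) pr_scale(2))
      show "(\<lambda>b. pr a b) ` A \<subseteq> A" using pr_closed by blast
      show "b = 0" if "b \<in> A" "pr a b = 0" for b
        using no_zero_div[OF a(1) that(1) _ that(2)] a(2) by blast
    qed
  next
    fix b assume b: "b \<in> A" "b \<noteq> 0"
    show "bij_betw (\<lambda>a. pr a b) A A"
    proof (rule P.bij_betw_linear_inj_on_subspace[OF subspace B(1,4)])
      show "Vector_Spaces.linear (\<lambda>k. Polynomial.smult (\<iota> k)) (\<lambda>k. Polynomial.smult (\<iota> k)) (\<lambda>a. pr a b)"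
        using P.vector_space_axioms by (simp add: Vector_Spaces.linear_iff pr_add(1) pr_scale(1))
      show "(\<lambda>a. pr a b) ` A \<subseteq> A" using pr_closed by blast
      show "a = 0" if "a \<in> A" "pr a b = 0" for a
        using no_zero_div[OF that(1) b that(2)] .
    qed
  next
    show "1 \<in> A" using d by (simp add: A_def)
    fix a assume a: "a \<in> A"
    \<comment> \<open>1 lies in \<open>range j\<close>, so its coordinate along
      \<open>\<gamma>\<close> is 0 and \<open>T 1 = 1\<close>.\<close>
    have "G 1 = 0"
      using gamma_component_eqI[OF j \<gamma>, of 1 0] by (simp add: G_def)
    then show "pr 1 a = a"
      using a A_iff by (auto simp: pr T_def intro: skew_mod_eqI[of _ 0])
    \<comment> \<open>\<open>T a\<close> is already a constant multiple of \<open>f\<close> plus the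
      remainder \<open>a\<close>.\<close>
    show "pr a 1 = a"
      unfolding pr using a A_iff
      by (intro skew_mod_eqI[of _ "- [:\<gamma> / coeff f 0 * G a:]"]) (simp_all add: T_def skew_mult_minus_left)
  qed (simp_all add: pr_add pr_scale pr_closed)
  then show ?thesis using dim by (simp add: pr_def A_def d_def)
qed

end
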